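(* Let $n=T_{k+1}-2$ for some integer $k\geq 1$, where $T_i=\binom{i+1}{2}$. Then $|\mathcal{M}^*_n|=1$, and the unique maximum weight jump-float sequence of length $n$ is the perfect sequence for $n$, $$p =(1,0,\underbrace{3,3}_{2},0,\underbrace{6,6,6}_{3},0,\underbrace{10,10,10,10}_{4},0,\ldots,0,\underbrace{T_k,\ldots,T_k}_{k}),$$ with weight $w_n^* = \sum_{i=1}^k i\,T_i$.
   Context: A jump-float sequence of length $n$ is an integer sequence $s=(s_1,\ldots,s_n)$ with $0\le s_i\le i$ for $1\le i\le n$ and such that, for $2\le i\le n$, if $s_i>s_{i-1}$ then $s_{i-1}=0$. Its weight is $w(s)=\sum_{i=1}^n s_i$. $w_n^*$ is the maximum weight over all jump-float sequences of length $n$, and $\mathcal{M}^*_n$ is the set of jump-float sequences of length $n$ with weight $w_n^*$. The perfect sequence for $n=T_{k+1}-2$ is the concatenation, for $i=1,\dots,k$ in order, of $i$ copies of $T_i$, with a single $0$ between consecutive such runs. *)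

theory Defs
  imports Main
begin

text \<open>Sequences \<open>(s\<^sub>1, \<dots>, s\<^sub>n)\<close> are integer lists of length \<open>n\<close>; since lists are
  indexed from 0, the entry \<open>s\<^sub>i\<close> is \<open>s ! (i - 1)\<close>.\<close>

definition jump_float :: "nat \<Rightarrow> int list \<Rightarrow> bool" where
  "jump_float n s \<longleftrightarrow>
     length s = n \<and>
     (\<forall>i\<in>{1..n}. 0 \<le> s ! (i - 1) \<and> s ! (i - 1) \<le> int i) \<and>
     (\<forall>i\<in>{2..n}. s ! (i - 1) > s ! (i - 2) \<longrightarrow> s ! (i - 2) = 0)"

definition weight :: "int list \<Rightarrow> int" where
  "weight s = sum_list s"

definition max_weight :: "nat \<Rightarrow> int" where
  "max_weight n = Max (weight ` {s. jump_float n s})"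

definition max_jump_floats :: "nat \<Rightarrow> int list set" where
  "max_jump_floats n = {s. jump_float n s \<and> weight s = max_weight n}"

definition T :: "nat \<Rightarrow> nat" where
  "T i = (i + 1) choose 2"

text \<open>The perfect sequence for \<open>n = T (k + 1) - 2\<close>: the separating 0 is placed in front of
  every run except the first.\<close>

definition perfect :: "nat \<Rightarrow> int list" where
  "perfect k =
     concat (map (\<lambda>i. (if i = 1 then [] else [0]) @ replicate i (int (T i))) [1..<k + 1])"

text \<open>The maximum in \<^const>\<open>max_weight\<close> ranges over a finite nonempty set.\<close>

lemma finite_jump_float: "finite {s. jump_float n s}"
proof (rule finite_subset)
  show "{s. jump_float n s} \<subseteq> {s. set s \<subseteq> {0..int n} \<and> length s = n}"
  proof clarify
    fix s assume s: "jump_float n s"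
    show "set s \<subseteq> {0..int n} \<and> length s = n"
    proof (intro conjI subsetI)
      fix x assume "x \<in> set s"
      then obtain j where j: "j < n" "x = s ! j"
        using s by (auto simp: jump_float_def in_set_conv_nth)
      then have "Suc j \<in> {1..n}" by auto
      then have "0 \<le> s ! (Suc j - 1) \<and> s ! (Suc j - 1) \<le> int (Suc j)"
        using s unfolding jump_float_def by blast
      then show "x \<in> {0..int n}" using j by auto
    qed (use s in \<open>simp add: jump_float_def\<close>)
  qed
  show "finite {s. set s \<subseteq> {0..int n} \<and> length s = n}"
    by (rule finite_lists_length_eq) simp
qed

lemma jump_float_nonempty: "{s. jump_float n s} \<noteq> {}"
proof -
  have "jump_float n (replicate n 0)" by (auto simp: jump_float_def)
  then show ?thesis by blast
qed

end

theory Submission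
  imports Defs
begin

text \<open>Between two consecutive zeros a jump-float sequence is weakly decreasing. So if the zeros are at
  the positions \<open>y\<^sub>1 - 1 < \<dots> < y\<^sub>r - 1\<close>, then with \<open>y\<^sub>0 = 1\<close> and \<open>y\<^bsub>r+1\<^esub> = n + 2\<close> the weight is at most
  the sum over \<open>j \<le> r\<close> of the \<open>y\<^sub>j * (y\<^bsub>j+1\<^esub> - y\<^sub>j - 1)\<close>. This optimisation problem has the value
  function \<open>F N = (\<Sum>i<N. i - t i)\<close>, where \<open>T (t i)\<close> is the largest triangular number
  \<open>\<le> i\<close>. Since \<open>F\<close> is convex, the inequality \<open>F M \<ge> F y + y * (M - y - 1)\<close> needs to be checked only
  where the slope of \<open>F\<close> is \<open>y\<close>, namely at \<open>M = y + t y + 1\<close>, and there it is an equality. If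
  \<open>M = T (k + 1)\<close>, then equality forces \<open>y = T k\<close>, so the optimal sequence is determined backwards
  from its last run.\<close>

section \<open>Triangular numbers and their discrete inverse\<close>

lemma T_0 [simp]: "T 0 = 0"
  by (simp add: T_def)

lemma T_Suc [simp]: "T (Suc i) = T i + Suc i"
  by (simp add: T_def numeral_2_eq_2)

lemma T_mono: "i \<le> j \<Longrightarrow> T i \<le> T j"
  by (rule lift_Suc_mono_le[of T]) auto

text \<open>This is the \<open>t\<close> of the overview: the largest \<open>k\<close> with
  \<open>T k <= n\<close>. It grows by at most one per step, so primitive recursion
  suffices.\<close>

primrec tri_root :: "nat \<Rightarrow> nat" where
  "tri_root 0 = 0"
| "tri_root (Suc n) = (if T (Suc (tri_root n)) \<le> Suc n then Suc (tri_root n) else tri_root n)"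

lemma tri_root_bounds: "T (tri_root n) \<le> n \<and> n < T (Suc (tri_root n))"
  by (induction n) auto

lemma tri_root_eqI:
  assumes "T k \<le> n" "n < T (Suc k)"
  shows "tri_root n = k"
  using T_mono[of "Suc k" "tri_root n"] T_mono[of "Suc (tri_root n)" k]
    tri_root_bounds[of n] assms by linarith

lemma tri_root_T [simp]: "tri_root (T k) = k"
  by (rule tri_root_eqI) auto

lemma tri_root_pos: "n \<ge> 1 \<Longrightarrow> tri_root n \<ge> 1"
  using tri_root_bounds[of n] by (cases "tri_root n") auto

lemma tri_root_le_add: "tri_root m \<le> tri_root (m + j)"
  by (induction j) auto

section \<open>The convex value function and its tangent inequality\<close>

definition slope :: "nat \<Rightarrow> int" where
  "slope n = int n - int (tri_root n)"

text \<open>Since \<open>tri_root\<close> rises by at most one per step, \<open>slope\<close> never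
  drops. This is the convexity of \<open>F\<close>.\<close>

lemma mono_slope: "m \<le> n \<Longrightarrow> slope m \<le> slope n"
  by (rule lift_Suc_mono_le[of slope]) (auto simp: slope_def)

text \<open>With \<open>t = tri_root y\<close>, both points \<open>y + j\<close> lie in the block
  from \<open>T (t + 1)\<close> up to \<open>T (t + 2) - 1\<close>. The slope is therefore
  \<open>y\<close> at the first point and \<open>y + 1\<close> at the second.\<close>

lemma slope_above:
  assumes "tri_root y + 1 \<le> j" "j \<le> tri_root y + 2"
  shows "slope (y + j) = int y + int j - int (tri_root y) - 1"
proof -
  have "tri_root (y + j) = Suc (tri_root y)"
    using tri_root_bounds[of y] assms by (intro tri_root_eqI) auto
  then show ?thesis by (simp add: slope_def)
qed

lemma slope_below: "slope (y + tri_root y) \<le> int y"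
  by (simp add: slope_def tri_root_le_add)

definition F :: "nat \<Rightarrow> int" where
  "F n = (\<Sum>i<n. slope i)"

lemma F_0 [simp]: "F 0 = 0"
  by (simp add: F_def)

lemma F_Suc [simp]: "F (Suc n) = F n + slope n"
  by (simp add: F_def)

lemma F_above: "F (m + j) \<ge> F m + slope m * int j"
proof (induction j)
  case (Suc j)
  then show ?case using mono_slope[of m "m + j"] by (simp add: algebra_simps)
qed simp

lemma F_below: "F m \<ge> F (m + j) - slope (m + j) * int j"
proof (induction j)
  case (Suc j)
  have "slope (m + j) * int (Suc j) \<le> slope (m + Suc j) * int (Suc j)"
    using mono_slope[of "m + j" "m + Suc j"] by (intro mult_right_mono) auto
  then show ?case using Suc by (simp add: algebra_simps)
qed simp

text \<open>Passing from \<open>y\<close> to \<open>y + 1\<close> moves the argument by one or two,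
  depending on whether \<open>tri_root\<close> grows. Fact 3 serves the first case, fact 4 the
  second.\<close>

lemma F_tight: "F (y + tri_root y + 1) = F y + int y * int (tri_root y)"
proof (induction y)
  case 0
  then show ?case by (simp add: slope_def)
next
  case (Suc y)
  have 1: "slope (Suc (y + tri_root y)) = int y"
    using slope_above[of y "tri_root y + 1"] by simp
  have 2: "slope (Suc (Suc (y + tri_root y))) = int y + 1"
    using slope_above[of y "tri_root y + 2"] by simp
  have 3: "F (Suc (Suc (y + tri_root y))) = F y + int y * int (tri_root y) + int y"
    using F_Suc[of "Suc (y + tri_root y)"] Suc 1 by (simp del: F_Suc)
  have 4: "F (Suc (Suc (Suc (y + tri_root y)))) = F y + int y * int (tri_root y) + 2 * int y + 1"
    using F_Suc[of "Suc (Suc (y + tri_root y))"] 2 3 by (simp del: F_Suc)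
  have 5: "F (Suc y) = F y + int y - int (tri_root y)"
    by (simp add: slope_def)
  show ?case
  proof (cases "T (Suc (tri_root y)) \<le> Suc y")
    case True
    then have "tri_root (Suc y) = Suc (tri_root y)" by simp
    then show ?thesis using 4 5 by (simp add: algebra_simps del: F_Suc tri_root.simps)
  next
    case False
    then have "tri_root (Suc y) = tri_root y" by simp
    then show ?thesis using 3 5 by (simp add: algebra_simps del: F_Suc tri_root.simps)
  qed
qed

text \<open>From \<open>y + tri_root y + 2\<close> on, slopes are at least \<open>y + 1\<close>, so
  each further step adds a surplus of at least 1. The surplus is what later excludes equality far
  from the touching point.\<close>

lemma F_far_right:
  assumes "M \<ge> y + tri_root y + 2"
  shows "F M \<ge> F y + int y * (int M - int y - 1) + (int M - int (y + tri_root y + 2))"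
proof -
  let ?k = "tri_root y"
  obtain j where j: "M = y + ?k + 2 + j" using assms le_Suc_ex by blast
  have 1: "slope (Suc (y + ?k)) = int y"
    using slope_above[of y "?k + 1"] by simp
  have 2: "slope (Suc (Suc (y + ?k))) = int y + 1"
    using slope_above[of y "?k + 2"] by simp
  show ?thesis
    using F_above[of "y + ?k + 2" j] F_tight[of y] 1 2 by (simp add: j algebra_simps)
qed

lemma F_far_left:
  assumes "M \<le> y + tri_root y" "y \<ge> 1"
  shows "F M \<ge> F y + int y * (int M - int y - 1) + (int (y + tri_root y) - int M)"
proof (cases "M = y + tri_root y")
  case True
  then show ?thesis using F_tight[of y] slope_below[of y] by (simp add: algebra_simps)
next
  case False
  let ?k = "tri_root y"
  obtain j where j: "y + ?k = Suc (M + j)"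
    using assms False by (metis le_neq_implies_less less_imp_Suc_add)
  have k: "?k \<ge> 1" using assms tri_root_pos by blast
  \<comment> \<open>One step before \<open>y + ?k\<close> the value of \<open>tri_root\<close> is
    still at least \<open>?k\<close>, so the slope there is at most \<open>y - 1\<close>. This
    yields the surplus on the left.\<close>
  have "M + j = y + (?k - 1)" using j k by simp
  then have "slope (M + j) \<le> int y - 1"
    using tri_root_le_add[of y "?k - 1"] k by (simp add: slope_def)
  moreover from this have "slope (M + j) * int j \<le> (int y - 1) * int j"
    by (intro mult_right_mono) auto
  moreover have "F (y + ?k) = F (M + j) + slope (M + j)" using j by simp
  moreover have "int (y + ?k) = int M + int j + 1" using j by simp
  moreover have "F (y + ?k) \<ge> F y + int y * (int ?k - 1)"
    using F_tight[of y] slope_below[of y] by (simp add: algebra_simps)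
  moreover have "int y * (int ?k - 1) = int y * (int M - int y - 1) + int y * (int j + 1)"
  proof -
    have "int ?k - 1 = (int M - int y - 1) + (int j + 1)"
      using \<open>int (y + ?k) = int M + int j + 1\<close> by simp
    then show ?thesis by (metis distrib_left)
  qed
  ultimately show ?thesis
    using F_below[of M j] by (simp add: algebra_simps)
qed

lemma F_step:
  assumes "y \<ge> 1"
  shows "F M \<ge> F y + int y * (int M - int y - 1)"
proof -
  let ?k = "tri_root y"
  consider "M \<ge> y + ?k + 2" | "M = y + ?k + 1" | "M \<le> y + ?k" by linarith
  then show ?thesis
  proof cases
    case 1
    then show ?thesis using F_far_right[OF 1] by linarith
  next
    case 2
    then show ?thesis using F_tight[of y] by simp
  next
    case 3
    then show ?thesis using F_far_left[OF 3 assms] by linarith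
  qed
qed

text \<open>The surpluses on both sides leave three candidates for \<open>T (k + 1)\<close>. Only
  the middle one is consistent with its being triangular.\<close>

lemma F_step_eq:
  assumes "y \<ge> 1" and eq: "F (T (k + 1)) = F y + int y * (int (T (k + 1)) - int y - 1)"
  shows "y = T k"
proof -
  let ?M = "T (k + 1)" and ?k = "tri_root y"
  have b: "T ?k \<le> y" "y < T ?k + Suc ?k" using tri_root_bounds[of y] by auto
  have "?M \<le> y + ?k + 2" using F_far_right[of y ?M] eq by linarith
  moreover have "?M \<ge> y + ?k" using F_far_left[of ?M y] eq assms(1) by linarith
  ultimately consider "?M = y + ?k + 2" | "?M = y + ?k + 1" | "?M = y + ?k" by linarith
  then show ?thesis
  proof cases
    case 1
    then have "tri_root ?M = Suc ?k" using b by (intro tri_root_eqI) auto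
    then have "k = ?k" unfolding tri_root_T by simp
    \<comment> \<open>Contradictory: here \<open>y = T k - 1\<close>, but
      \<open>T k <= y\<close>.\<close>
    then show ?thesis using 1 b T_Suc[of k] by simp
  next
    case 2
    then have "tri_root ?M = Suc ?k" using b by (intro tri_root_eqI) auto
    then have "k = ?k" unfolding tri_root_T by simp
    then show ?thesis using 2 T_Suc[of k] by simp
  next
    case 3
    \<comment> \<open>The equation at \<open>?M\<close> and \<open>F_tight\<close> at
      \<open>?M + 1\<close> differ by \<open>y\<close>. The resulting \<open>T ?k = y + ?k\<close>
      contradicts \<open>T ?k <= y\<close>, as \<open>?k\<close> is positive.\<close>
    then have "slope ?M = int y"
      using eq F_tight[of y] slope_below[of y] by (simp add: algebra_simps)
    then have "tri_root ?M = ?k" unfolding slope_def 3 by simp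
    then have "k + 1 = ?k" unfolding tri_root_T .
    then show ?thesis using 3 b tri_root_pos[OF assms(1)] by simp
  qed
qed

text \<open>\<open>T (k + 1)\<close> is the touching point for \<open>y = T k\<close>, so
  \<open>F_tight\<close> gives the recurrence.\<close>

lemma F_T: "F (T (k + 1)) = (\<Sum>i=1..k. int i * int (T i))"
proof (induction k)
  case 0
  then show ?case by (simp add: slope_def)
next
  case (Suc k)
  have "T (Suc k) + tri_root (T (Suc k)) + 1 = T (Suc k + 1)"
    unfolding tri_root_T by simp
  then have "F (T (Suc k + 1)) = F (T (Suc k)) + int (T (Suc k)) * int (Suc k)"
    using F_tight[of "T (Suc k)"] by (metis tri_root_T)
  then show ?case using Suc by (simp add: mult.commute del: F_Suc T_Suc)
qed

section \<open>Prefixes, appended runs and zero-free stretches of jump-float sequences\<close>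

lemma jump_float_iff:
  "jump_float n s \<longleftrightarrow> length s = n \<and> (\<forall>i<n. 0 \<le> s ! i \<and> s ! i \<le> int i + 1) \<and>
     (\<forall>i. Suc i < n \<longrightarrow> s ! i < s ! Suc i \<longrightarrow> s ! i = 0)"
proof -
  have "(\<forall>i\<in>{1..n}. P i) \<longleftrightarrow> (\<forall>i<n. P (Suc i))" for P
    by (metis One_nat_def Suc_le_eq Suc_le_mono Suc_pred atLeastAtMost_iff zero_less_Suc)
  moreover have "(\<forall>i\<in>{2..n}. P i) \<longleftrightarrow> (\<forall>i. Suc i < n \<longrightarrow> P (Suc (Suc i)))" for P
  proof safe
    fix i assume a: "\<forall>i. Suc i < n \<longrightarrow> P (Suc (Suc i))" "i \<in> {2..n}"
    then obtain j where "i = Suc (Suc j)"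
      by (metis One_nat_def Suc_1 Suc_le_D atLeastAtMost_iff Suc_le_mono)
    then show "P i" using a by simp
  qed simp
  ultimately show ?thesis
    unfolding jump_float_def by (simp add: add.commute numeral_2_eq_2)
qed

lemma jump_float_prefix:
  assumes "jump_float n (ys @ zs)"
  shows "jump_float (length ys) ys"
proof -
  have "ys ! i = (ys @ zs) ! i" if "i < length ys" for i
    using that by (simp add: nth_append)
  then show ?thesis
    using assms unfolding jump_float_iff by (simp del: nth_append_left)
qed

text \<open>The run starts at 0-based index \<open>n + 1\<close>, where the cap is
  \<open>n + 2\<close>; later caps are larger.\<close>

lemma jump_float_append_run:
  assumes s: "jump_float n s" and "0 \<le> c" "c \<le> int n + 2"
  shows "jump_float (n + 1 + m) (s @ 0 # replicate m c)"
proof -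
  have len: "length s = n" using s by (simp add: jump_float_iff)
  have nth: "(s @ 0 # replicate m c) ! i = (if i < n then s ! i else if i = n then 0 else c)"
    if "i < n + 1 + m" for i
    using that len by (auto simp: nth_append nth_Cons')
  show ?thesis
    unfolding jump_float_iff
  proof (intro conjI allI impI)
    fix i assume i: "i < n + 1 + m"
    show "0 \<le> (s @ 0 # replicate m c) ! i"
      using s assms(2) by (simp add: nth[OF i] jump_float_iff)
    show "(s @ 0 # replicate m c) ! i \<le> int i + 1"
      using s assms(3) by (auto simp: nth[OF i] jump_float_iff)
  next
    fix i assume i: "Suc i < n + 1 + m"
      and less: "(s @ 0 # replicate m c) ! i < (s @ 0 # replicate m c) ! Suc i"
    have i': "i < n + 1 + m" using i by simp
    show "(s @ 0 # replicate m c) ! i = 0"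
    proof (rule ccontr)
      assume "(s @ 0 # replicate m c) ! i \<noteq> 0"
      moreover have "s ! i \<ge> 0" if "i < n" using that s by (simp add: jump_float_iff)
      moreover have "s ! Suc i \<le> s ! i" if "Suc i < n" "s ! i \<noteq> 0"
        using that s by (meson jump_float_iff not_le)
      ultimately show False
        using less unfolding nth[OF i] nth[OF i'] by (simp split: if_splits)
    qed
  qed (simp add: len)
qed

text \<open>Without a zero in between the sequence cannot rise, so the cap at index \<open>a\<close>
  persists up to \<open>j\<close>.\<close>

lemma run_bounded:
  assumes s: "jump_float n s" and "a \<le> j" "j < n" and "\<And>i. a \<le> i \<Longrightarrow> i < j \<Longrightarrow> s ! i \<noteq> 0"
  shows "s ! j \<le> int a + 1"
  using assms(2-)
proof (induction j rule: dec_induct)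
  case base
  then show ?case using s by (simp add: jump_float_iff)
next
  case (step j)
  then have "s ! Suc j \<le> s ! j" using s unfolding jump_float_iff by (meson lessI not_le)
  moreover have "s ! j \<le> int a + 1" using step by simp
  ultimately show ?case by simp
qed

lemma suffix_bounded:
  assumes s: "jump_float n (xs @ zs)" and "0 \<notin> set zs" "x \<in> set zs"
  shows "x \<le> int (length xs) + 1"
proof -
  obtain j where j: "j < length zs" "x = zs ! j" using assms(3) by (auto simp: in_set_conv_nth)
  have "n = length xs + length zs" using s by (simp add: jump_float_iff)
  moreover have "(xs @ zs) ! i \<noteq> 0" if "length xs \<le> i" "i < length xs + j" for i
    using that j assms(2) by (simp add: nth_append)
      (metis add_diff_inverse_nat leD less_trans nat_add_left_cancel_less nth_mem)
  ultimately show ?thesis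
    using run_bounded[OF s, of "length xs" "length xs + j"] j by simp
qed

section \<open>The upper bound on the weight\<close>

lemma sum_list_bounded:
  fixes c :: int
  assumes "\<And>x. x \<in> set xs \<Longrightarrow> x \<le> c"
  shows "sum_list xs \<le> c * int (length xs)"
  using assms by (induction xs) (force simp: algebra_simps)+

lemma sum_list_bounded_eq:
  fixes c :: int
  assumes "\<And>x. x \<in> set xs \<Longrightarrow> x \<le> c" "sum_list xs = c * int (length xs)"
  shows "xs = replicate (length xs) c"
  using assms
proof (induction xs)
  case (Cons x xs)
  have "x \<le> c" "sum_list xs \<le> c * int (length xs)"
    using Cons.prems(1) by (auto intro: sum_list_bounded)
  moreover have "x + sum_list xs = c + c * int (length xs)"
    using Cons.prems(2) by (simp add: algebra_simps)
  ultimately have "x = c" "sum_list xs = c * int (length xs)" by linarith+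
  then show ?case using Cons by simp
qed simp

lemma weight_le_F: "jump_float n s \<Longrightarrow> weight s \<le> F (n + 2)"
proof (induction n arbitrary: s rule: less_induct)
  case (less n)
  have len: "length s = n" using less.prems by (simp add: jump_float_iff)
  show ?case
  proof (cases "0 \<in> set s")
    case True
    then obtain ys zs where s: "s = ys @ 0 # zs" "0 \<notin> set zs" by (auto dest: split_list_last)
    \<comment> \<open>The same number is the argument of \<open>F\<close> for the prefix
      \<open>ys\<close> and the cap on the entries of \<open>zs\<close>, whose first index is
      \<open>length ys + 1\<close>. This is the reason for the shift by 2 in
      \<open>F (n + 2)\<close>.\<close>
    let ?y = "length ys + 2"
    have "weight ys \<le> F ?y"
      using less jump_float_prefix s len by fastforce
    moreover have "sum_list zs \<le> int ?y * int (length zs)"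
      using suffix_bounded[of n "ys @ [0]" zs] less.prems s
      by (intro sum_list_bounded) (simp add: add.commute)
    moreover have "F (n + 2) \<ge> F ?y + int ?y * (int (n + 2) - int ?y - 1)"
      by (rule F_step) simp
    moreover have "int (n + 2) - int ?y - 1 = int (length zs)" using s len by auto
    ultimately show ?thesis using s by (simp add: weight_def)
  next
    case False
    \<comment> \<open>Without zeros the whole sequence is one run capped by its first entry, which
      corresponds to \<open>y = 1\<close> with \<open>F 1 = 0\<close>.\<close>
    have "sum_list s \<le> 1 * int (length s)"
      using suffix_bounded[of n "[]" s] less.prems False by (intro sum_list_bounded) simp
    then show ?thesis using F_step[of 1 "n + 2"] len by (simp add: weight_def slope_def)
  qed
qed

section \<open>The perfect sequence attains the bound and is the only one to do so\<close>

lemma perfect_1: "perfect 1 = [1]"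
  by (simp add: perfect_def)

lemma perfect_Suc: "k \<ge> 1 \<Longrightarrow> perfect (Suc k) = perfect k @ 0 # replicate (Suc k) (int (T (Suc k)))"
  by (simp add: perfect_def)

lemma jump_float_perfect:
  assumes "k \<ge> 1"
  shows "jump_float (T (k + 1) - 2) (perfect k) \<and> weight (perfect k) = F (T (k + 1))"
  using assms
proof (induction k rule: nat_induct_at_least)
  case base
  show ?case unfolding perfect_1 F_T by (simp add: jump_float_iff weight_def)
next
  case (Suc k)
  have T2: "T (k + 1) \<ge> 2" using Suc by simp
  \<comment> \<open>The value of the new run is exactly the cap at its first position.\<close>
  then have "int (T (Suc k)) \<le> int (T (k + 1) - 2) + 2" by simp
  then have "jump_float (T (k + 1) - 2 + 1 + Suc k) (perfect (Suc k))"
    unfolding perfect_Suc[OF Suc.hyps] using Suc.IH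
    by (intro jump_float_append_run) auto
  moreover have "T (k + 1) - 2 + 1 + Suc k = T (Suc k + 1) - 2" using T2 by simp
  moreover have "weight (perfect (Suc k)) = F (T (Suc k + 1))"
    unfolding perfect_Suc[OF Suc.hyps] using Suc.IH
    unfolding F_T by (simp add: weight_def sum_list_replicate algebra_simps del: T_Suc)
  ultimately show ?case by metis
qed

text \<open>Optimality turns every estimate in the proof of \<open>weight_le_F\<close> into an
  equality. \<open>F_step_eq\<close> then locates the last zero, the last run is constant at its
  cap, and the prefix is optimal for the preceding \<open>k\<close>.\<close>

lemma optimal_imp_perfect:
  assumes "k \<ge> 1" "jump_float (T (k + 1) - 2) s" "weight s = F (T (k + 1))"
  shows "s = perfect k"
  using assms
proof (induction k arbitrary: s)
  case (Suc k)
  let ?M = "T (Suc k + 1)"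
  have M: "?M \<ge> 2" by simp
  have len: "length s + 2 = ?M" using Suc.prems M by (simp add: jump_float_iff)
  show ?case
  proof (cases "0 \<in> set s")
    case True
    then obtain ys zs where s: "s = ys @ 0 # zs" "0 \<notin> set zs" by (auto dest: split_list_last)
    let ?y = "length ys + 2"
    have ys: "jump_float (length ys) ys" using jump_float_prefix Suc.prems s by blast
    have 1: "weight ys \<le> F ?y" using weight_le_F ys by blast
    have z: "x \<le> int ?y" if "x \<in> set zs" for x
      using suffix_bounded[of "?M - 2" "ys @ [0]" zs x] Suc.prems s that
      by (simp add: add.commute)
    have 2: "sum_list zs \<le> int ?y * int (length zs)"
      using z by (rule sum_list_bounded)
    have 3: "F ?M \<ge> F ?y + int ?y * (int ?M - int ?y - 1)"
      by (rule F_step) simp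
    have l: "int ?M - int ?y - 1 = int (length zs)"
      unfolding len[symmetric] using s by simp
    have w: "weight s = weight ys + sum_list zs" using s by (simp add: weight_def)
    have tight: "weight ys = F ?y" "sum_list zs = int ?y * int (length zs)"
      using 1 2 3[unfolded l] w Suc.prems(3) by linarith+
    then have y: "?y = T (Suc k)"
      using l w Suc.prems(3) by (intro F_step_eq) auto
    \<comment> \<open>A zero in \<open>s\<close> makes \<open>?y\<close> at least 2, whereas
      \<open>T 1 = 1\<close>.\<close>
    have "k \<noteq> 0" using y by (intro notI) simp
    have "length zs = Suc k" using l y by simp
    then have zs: "zs = replicate (Suc k) (int (T (Suc k)))"
      using sum_list_bounded_eq[of zs, OF z tight(2)] y by metis
    have "length ys = T (Suc k) - 2" using y by linarith
    then have "ys = perfect k"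
      using Suc.IH[of ys] ys y tight(1) \<open>k \<noteq> 0\<close> by simp
    then show ?thesis using s zs perfect_Suc \<open>k \<noteq> 0\<close> by simp
  next
    case False
    have z: "x \<le> 1" if "x \<in> set s" for x
      using suffix_bounded[of "?M - 2" "[]" s] Suc.prems False that by simp
    have 1: "sum_list s \<le> 1 * int (length s)"
      using z by (rule sum_list_bounded)
    have F1: "F 1 = 0" by (simp add: slope_def)
    have l: "int ?M - int 1 - 1 = int (length s)" unfolding len[symmetric] by simp
    have 2: "F ?M \<ge> F 1 + int 1 * (int ?M - int 1 - 1)" by (rule F_step) simp
    have w: "sum_list s = F ?M" using Suc.prems(3) by (simp add: weight_def)
    \<comment> \<open>A zero-free optimum is the case \<open>y = 1\<close> of the equality analysis,
      so it occurs only for the shortest length.\<close>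
    have "1 = T (Suc k)" using 1 2 l F1 w by (intro F_step_eq) auto
    then have "k = 0" by (cases k) auto
    then have "length s = 1" using len by simp
    moreover have "sum_list s = 1 * int (length s)"
      using 1 2[unfolded l] F1 w by linarith
    ultimately have "s = [1]" using sum_list_bounded_eq[of s 1, OF z] by simp
    then show ?thesis using perfect_1 \<open>k = 0\<close> by simp
  qed
qed simp

theorem theorem2p14:
  fixes k n :: nat
  assumes "k \<ge> 1" and "n = T (k + 1) - 2"
  shows "card (max_jump_floats n) = 1 \<and>
         max_jump_floats n = {perfect k} \<and>
         max_weight n = (\<Sum>i=1..k. int i * int (T i))"
proof -
  have n: "n + 2 = T (k + 1)" using assms by simp
  have p: "jump_float n (perfect k)" "weight (perfect k) = F (n + 2)"
    unfolding n using jump_float_perfect[OF assms(1)] assms(2) by (auto simp del: T_Suc F_Suc)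
  have max: "max_weight n = F (n + 2)"
    unfolding max_weight_def
  proof (rule Max_eqI)
    show "F (n + 2) \<in> weight ` {s. jump_float n s}"
      using p by (metis imageI mem_Collect_eq)
  qed (use weight_le_F finite_jump_float in auto)
  have "s = perfect k" if "jump_float n s" "weight s = F (n + 2)" for s
    using optimal_imp_perfect[OF assms(1)] that assms(2) unfolding n by blast
  then have "max_jump_floats n = {perfect k}"
    unfolding max_jump_floats_def max using p by blast
  moreover have "max_weight n = (\<Sum>i=1..k. int i * int (T i))"
    unfolding max n by (rule F_T)
  ultimately show ?thesis by simp
qed

end
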